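(* Let $k \ge 1$ be an integer, and let $X$ and $Y$ be strings of lengths $m$ and $n$ respectively over an alphabet $\Sigma$, with $n \ge m$. The length of a longest common subsequence in at least $k$ length substrings (an LCS$_{k^+}$) of $X$ and $Y$ can be computed in $O(mn)$ time and $O(km)$ space.
   Context: For a string $X=X[1]\cdots X[n]$, write $X[i:j]=X[i]X[i+1]\cdots X[j]$ and $X[i..l] := X[i:i+l-1]$ for the length-$l$ substring starting at $i$. Given strings $X$ (length $m$), $Y$ (length $n$) and an integer $k\ge 1$, a string $Z$ is a common subsequence in at least $k$ length substrings of $X$ and $Y$ if there exist $t\ge 0$, indices $i_1,\dots,i_t$, $j_1,\dots,j_t$, $p_1,\dots,p_t$ and lengths $l_1,\dots,l_t$ such that for all $1\le s\le t$: $l_s\ge k$ and $X[i_s..l_s]=Y[j_s..l_s]=Z[p_s..l_s]$; for $1\le s<t$: $i_s+l_s\le i_{s+1}$, $j_s+l_s\le j_{s+1}$, $p_{s+1}=p_s+l_s$; and $p_1=1$, $|Z|=p_t+l_t-1$. An LCS$_{k^+}$ of $X$ and $Y$ is such a $Z$ of maximum length. Complexities are in the standard RAM model where symbol equality comparisons take constant time. *)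

theory Defs
  imports Main
begin

section \<open>Common subsequences in at least k length substrings\<close>

text \<open>Positions are 1-based. Since \<^const>\<open>take\<close> and \<^const>\<open>drop\<close> are total, the fact that
  \<open>X[i..l]\<close> lies inside \<open>X\<close> is the separate predicate \<open>valid_sub\<close>.\<close>

definition sub :: "'a list \<Rightarrow> nat \<Rightarrow> nat \<Rightarrow> 'a list" where
  "sub X i l = take l (drop (i - 1) X)"

definition valid_sub :: "'a list \<Rightarrow> nat \<Rightarrow> nat \<Rightarrow> bool" where
  "valid_sub X i l \<longleftrightarrow> 1 \<le> i \<and> i + l \<le> length X + 1"

text \<open>For \<open>t = 0\<close> there are no \<open>p\<^sub>1\<close>, \<open>p\<^sub>t\<close>, \<open>l\<^sub>t\<close>, and the subsequence is the empty string.\<close>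

definition common_subseq_kplus :: "nat \<Rightarrow> 'a list \<Rightarrow> 'a list \<Rightarrow> 'a list \<Rightarrow> bool" where
  "common_subseq_kplus k X Y Z \<longleftrightarrow>
    (\<exists>(t::nat) (i::nat \<Rightarrow> nat) (j::nat \<Rightarrow> nat) (p::nat \<Rightarrow> nat) (l::nat \<Rightarrow> nat).
      (\<forall>s\<in>{1..t}. k \<le> l s
          \<and> valid_sub X (i s) (l s) \<and> valid_sub Y (j s) (l s) \<and> valid_sub Z (p s) (l s)
          \<and> sub X (i s) (l s) = sub Y (j s) (l s)
          \<and> sub Y (j s) (l s) = sub Z (p s) (l s))
      \<and> (\<forall>s\<in>{1..<t}. i s + l s \<le> i (s + 1) \<and> j s + l s \<le> j (s + 1) \<and> p (s + 1) = p s + l s)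
      \<and> (if t = 0 then Z = [] else p 1 = 1 \<and> length Z = p t + l t - 1))"

definition is_LCS_kplus :: "nat \<Rightarrow> 'a list \<Rightarrow> 'a list \<Rightarrow> 'a list \<Rightarrow> bool" where
  "is_LCS_kplus k X Y Z \<longleftrightarrow> is_arg_max length (common_subseq_kplus k X Y) Z"


section \<open>Random access machine with read-only input strings\<close>

text \<open>
  Memory is a sequence of words holding natural numbers. The input strings \<open>X\<close> and \<open>Y\<close> are
  read-only, lie outside the working memory, and are accessible only through equality tests
  between two of their symbols, which are addressed by 0-based positions. All numbers in the
  instructions other than the constant of \<open>Const\<close> and jump targets are memory addresses.
\<close>

datatype source = InX | InY

datatype instr =
    Const nat nat                            \<comment> \<open>\<open>M[d] := v\<close>\<close>
  | Move nat nat                             \<comment> \<open>\<open>M[d] := M[a]\<close>\<close>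
  | Add nat nat nat                          \<comment> \<open>\<open>M[d] := M[a] + M[b]\<close>\<close>
  | Sub nat nat nat                          \<comment> \<open>\<open>M[d] := M[a] - M[b]\<close>, truncated at \<open>0\<close>\<close>
  | Mult nat nat nat                         \<comment> \<open>\<open>M[d] := M[a] * M[b]\<close>\<close>
  | Load nat nat                             \<comment> \<open>\<open>M[d] := M[M[a]]\<close>\<close>
  | Store nat nat                            \<comment> \<open>\<open>M[M[d]] := M[a]\<close>\<close>
  | Jump nat
  | JumpLess nat nat nat                     \<comment> \<open>jump if \<open>M[a] < M[b]\<close>\<close>
  | JumpSymEq source nat source nat nat      \<comment> \<open>jump if the symbols at \<open>M[a]\<close>, \<open>M[b]\<close> are equal\<close>
  | Halt

type_synonym mem = "nat \<Rightarrow> nat"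
type_synonym config = "nat \<times> mem"

primrec input :: "'a list \<Rightarrow> 'a list \<Rightarrow> source \<Rightarrow> 'a list" where
  "input X Y InX = X"
| "input X Y InY = Y"

primrec exec :: "'a list \<Rightarrow> 'a list \<Rightarrow> instr \<Rightarrow> nat \<Rightarrow> mem \<Rightarrow> config" where
  "exec X Y (Const d v) pc M = (pc + 1, M(d := v))"
| "exec X Y (Move d a) pc M = (pc + 1, M(d := M a))"
| "exec X Y (Add d a b) pc M = (pc + 1, M(d := M a + M b))"
| "exec X Y (Sub d a b) pc M = (pc + 1, M(d := M a - M b))"
| "exec X Y (Mult d a b) pc M = (pc + 1, M(d := M a * M b))"
| "exec X Y (Load d a) pc M = (pc + 1, M(d := M (M a)))"
| "exec X Y (Store d a) pc M = (pc + 1, M(M d := M a))"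
| "exec X Y (Jump q) pc M = (q, M)"
| "exec X Y (JumpLess a b q) pc M = (if M a < M b then q else pc + 1, M)"
| "exec X Y (JumpSymEq u a v b q) pc M =
    (if input X Y u ! M a = input X Y v ! M b then q else pc + 1, M)"
| "exec X Y Halt pc M = (pc, M)"

primrec accessed :: "instr \<Rightarrow> mem \<Rightarrow> nat set" where
  "accessed (Const d v) M = {d}"
| "accessed (Move d a) M = {d, a}"
| "accessed (Add d a b) M = {d, a, b}"
| "accessed (Sub d a b) M = {d, a, b}"
| "accessed (Mult d a b) M = {d, a, b}"
| "accessed (Load d a) M = {d, a, M a}"
| "accessed (Store d a) M = {d, a, M d}"
| "accessed (Jump q) M = {}"
| "accessed (JumpLess a b q) M = {a, b}"
| "accessed (JumpSymEq u a v b q) M = {a, b}"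
| "accessed Halt M = {}"

fun input_in_range :: "'a list \<Rightarrow> 'a list \<Rightarrow> instr \<Rightarrow> mem \<Rightarrow> bool" where
  "input_in_range X Y (JumpSymEq u a v b q) M \<longleftrightarrow>
    M a < length (input X Y u) \<and> M b < length (input X Y v)"
| "input_in_range X Y _ M \<longleftrightarrow> True"

text \<open>
  One step of program \<open>P\<close> on a machine with \<open>S\<close> words of memory, each of which can hold the
  numbers below \<open>W\<close>. The machine gets stuck if it addresses a word outside its memory, produces
  a number that does not fit into a word, or reads past the end of an input string.
\<close>

definition ram_step ::
  "instr list \<Rightarrow> 'a list \<Rightarrow> 'a list \<Rightarrow> nat \<Rightarrow> nat \<Rightarrow> config \<Rightarrow> config \<Rightarrow> bool" where
  "ram_step P X Y S W c c' \<longleftrightarrow>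
    (case c of (pc, M) \<Rightarrow>
      pc < length P \<and> P ! pc \<noteq> Halt
      \<and> accessed (P ! pc) M \<subseteq> {..<S}
      \<and> input_in_range X Y (P ! pc) M
      \<and> c' = exec X Y (P ! pc) pc M
      \<and> (\<forall>a. snd c' a < W))"

definition init_mem :: "nat \<Rightarrow> nat \<Rightarrow> nat \<Rightarrow> mem" where
  "init_mem k m n = (\<lambda>_. 0)(0 := k, 1 := m, 2 := n)"

text \<open>On input \<open>k\<close>, \<open>X\<close>, \<open>Y\<close> the program halts after exactly \<open>t\<close> steps with output \<open>r\<close> in word
  \<open>0\<close>, on the machine with \<open>S\<close> words of memory holding numbers below \<open>W\<close>.\<close>

definition ram_computes ::
  "instr list \<Rightarrow> nat \<Rightarrow> 'a list \<Rightarrow> 'a list \<Rightarrow> nat \<Rightarrow> nat \<Rightarrow> nat \<Rightarrow> nat \<Rightarrow> bool" where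
  "ram_computes P k X Y S W t r \<longleftrightarrow>
    (\<exists>pc M. (ram_step P X Y S W ^^ t) (0, init_mem k (length X) (length Y)) (pc, M)
      \<and> pc < length P \<and> P ! pc = Halt \<and> M 0 = r)"

end

theory Submission
  imports Defs
begin

text \<open>
  Let \<open>F i j\<close> be the optimum for the prefixes \<open>X[1:i]\<close>, \<open>Y[1:j]\<close>, and let \<open>E i j\<close> be the
  optimum among the solutions whose last block ends at both \<open>i\<close> and \<open>j\<close>. Such a block either has
  length exactly \<open>k\<close>, which gives \<open>F (i - k) (j - k) + k\<close>, or it extends a block of length at
  least \<open>k\<close> ending at \<open>i - 1\<close>, \<open>j - 1\<close>, which gives \<open>E (i - 1) (j - 1) + 1\<close>. So each of the
  \<open>m n\<close> table cells takes constant time. Filling the table row by row along \<open>Y\<close> only looks back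
  \<open>k\<close> rows, each of length \<open>m + 1\<close>, so a cyclic buffer of \<open>k + 1\<close> rows suffices. If \<open>m < k\<close>
  the answer is \<open>0\<close>.
\<close>

section \<open>Blocks of common subsequences\<close>

lemma valid_sub_append: "valid_sub X i l \<Longrightarrow> valid_sub (X @ A) i l"
  by (simp add: valid_sub_def)

lemma sub_append: "valid_sub X i l \<Longrightarrow> sub (X @ A) i l = sub X i l"
  by (simp add: valid_sub_def sub_def)

lemma sub_take: "i + l \<le> b + 1 \<Longrightarrow> 1 \<le> i \<Longrightarrow> sub (take b X) i l = sub X i l"
  by (cases i) (auto simp: sub_def drop_take min_def)

lemma valid_sub_take:
  "valid_sub X i l \<Longrightarrow> i + l \<le> b + 1 \<Longrightarrow> valid_sub (take b X) i l"
  by (auto simp: valid_sub_def min_def)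

lemma common_subseq_kplus_Nil: "common_subseq_kplus k X Y []"
  unfolding common_subseq_kplus_def by (rule exI[of _ 0]) simp

lemma common_subseq_kplus_append:
  assumes "common_subseq_kplus k X Y Z"
  shows "common_subseq_kplus k (X @ A) (Y @ B) Z"
proof -
  obtain t i j p l where
    "\<forall>s\<in>{1..t::nat}. k \<le> l s
          \<and> valid_sub X (i s) (l s) \<and> valid_sub Y (j s) (l s) \<and> valid_sub Z (p s) (l s)
          \<and> sub X (i s) (l s) = sub Y (j s) (l s)
          \<and> sub Y (j s) (l s) = sub Z (p s) (l s)"
    "\<forall>s\<in>{1..<t}. i s + l s \<le> i (s + 1) \<and> j s + l s \<le> j (s + 1) \<and> p (s + 1) = p s + l s"
    "if t = 0 then Z = [] else p 1 = 1 \<and> length Z = p t + l t - 1"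
    using assms unfolding common_subseq_kplus_def by blast
  note c = this
  show ?thesis
    unfolding common_subseq_kplus_def
    by (rule exI[of _ t], rule exI[of _ i], rule exI[of _ j], rule exI[of _ p], rule exI[of _ l])
      (use c in \<open>simp add: valid_sub_append sub_append\<close>)
qed

text \<open>The new block starts right behind the ends of the three strings, so it is disjoint from
  all earlier blocks and contiguous with them in \<open>Z\<close>.\<close>

lemma common_subseq_kplus_snoc_block:
  assumes "common_subseq_kplus k X Y Z" and L: "k \<le> length L"
  shows "common_subseq_kplus k (X @ L) (Y @ L) (Z @ L)"
proof -
  obtain t i j p l where
    c: "\<And>s. s\<in>{1..t::nat} \<Longrightarrow> k \<le> l s
          \<and> valid_sub X (i s) (l s) \<and> valid_sub Y (j s) (l s) \<and> valid_sub Z (p s) (l s)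
          \<and> sub X (i s) (l s) = sub Y (j s) (l s)
          \<and> sub Y (j s) (l s) = sub Z (p s) (l s)" and
    d: "\<And>s. s\<in>{1..<t} \<Longrightarrow> i s + l s \<le> i (s + 1) \<and> j s + l s \<le> j (s + 1) \<and> p (s + 1) = p s + l s" and
    e: "if t = 0 then Z = [] else p 1 = 1 \<and> length Z = p t + l t - 1"
    using assms unfolding common_subseq_kplus_def by blast
  define i' where "i' = i(Suc t := Suc (length X))"
  define j' where "j' = j(Suc t := Suc (length Y))"
  define p' where "p' = p(Suc t := Suc (length Z))"
  define l' where "l' = l(Suc t := length L)"
  note defs = i'_def j'_def p'_def l'_def
  have 1: "k \<le> l' s
          \<and> valid_sub (X @ L) (i' s) (l' s) \<and> valid_sub (Y @ L) (j' s) (l' s) \<and> valid_sub (Z @ L) (p' s) (l' s)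
          \<and> sub (X @ L) (i' s) (l' s) = sub (Y @ L) (j' s) (l' s)
          \<and> sub (Y @ L) (j' s) (l' s) = sub (Z @ L) (p' s) (l' s)" if "s \<in> {1..Suc t}" for s
  proof (cases "s = Suc t")
    case True
    then show ?thesis using L by (simp add: defs valid_sub_def sub_def)
  next
    case False
    then show ?thesis using c[of s] that by (simp add: defs valid_sub_append sub_append)
  qed
  have 2: "i' s + l' s \<le> i' (s + 1) \<and> j' s + l' s \<le> j' (s + 1) \<and> p' (s + 1) = p' s + l' s"
    if "s \<in> {1..<Suc t}" for s
  proof (cases "s = t")
    case True
    then show ?thesis using c[of t] e that by (auto simp: defs valid_sub_def)
  next
    case False
    then show ?thesis using d[of s] that by (simp add: defs)
  qed
  have 3: "p' 1 = 1 \<and> length (Z @ L) = p' (Suc t) + l' (Suc t) - 1"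
    using e by (auto simp: defs split: if_splits)
  show ?thesis
    unfolding common_subseq_kplus_def
    by (rule exI[of _ "Suc t"], rule exI[of _ i'], rule exI[of _ j'], rule exI[of _ p'], rule exI[of _ l'])
      (use 1 2 3 in auto)
qed

text \<open>The definition separates only neighbouring blocks; cutting a string before its last
  block needs every earlier block to end before the cut.\<close>

lemma chain_le:
  fixes i l :: "nat \<Rightarrow> nat"
  assumes "\<And>s. s \<in> {1..<t} \<Longrightarrow> i s + l s \<le> i (s + 1)" "1 \<le> s" "s < t"
  shows "i s + l s \<le> i t"
proof -
  have "Suc s \<le> t" using assms(3) by simp
  then show ?thesis using assms(1)
  proof (induction t rule: dec_induct)
    case base
    then show ?case using assms(2) by simp
  next
    case (step q)
    have "i s + l s \<le> i q" by (rule step.IH) (use step.prems in simp)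
    moreover have "i q + l q \<le> i (q + 1)" using step.prems[of q] step.hyps by simp
    ultimately show ?case by simp
  qed
qed

text \<open>Converse of \<open>common_subseq_kplus_snoc_block\<close>: cut all three strings just
  before the last block. Symbols may follow it in \<open>X\<close> and \<open>Y\<close>, but not in
  \<open>Z\<close>, whose length is fixed by that block.\<close>

lemma common_subseq_kplus_last_block:
  assumes "common_subseq_kplus k X Y Z" and "Z \<noteq> []"
  obtains X' Y' Z' L A B where "X = X' @ L @ A" "Y = Y' @ L @ B" "Z = Z' @ L" "k \<le> length L"
    "common_subseq_kplus k X' Y' Z'"
proof -
  obtain t i j p l where
    c: "\<And>s. s\<in>{1..t::nat} \<Longrightarrow> k \<le> l s
          \<and> valid_sub X (i s) (l s) \<and> valid_sub Y (j s) (l s) \<and> valid_sub Z (p s) (l s)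
          \<and> sub X (i s) (l s) = sub Y (j s) (l s)
          \<and> sub Y (j s) (l s) = sub Z (p s) (l s)" and
    d: "\<And>s. s\<in>{1..<t} \<Longrightarrow> i s + l s \<le> i (s + 1) \<and> j s + l s \<le> j (s + 1) \<and> p (s + 1) = p s + l s" and
    e: "if t = 0 then Z = [] else p 1 = 1 \<and> length Z = p t + l t - 1"
    using assms unfolding common_subseq_kplus_def by blast
  have t: "t \<ge> 1" using e assms(2) by (cases t) auto
  define L where "L = sub X (i t) (l t)"
  have ct: "k \<le> l t" "valid_sub X (i t) (l t)" "valid_sub Y (j t) (l t)" "valid_sub Z (p t) (l t)"
    "sub Y (j t) (l t) = L" "sub Z (p t) (l t) = L"
    using c[of t] t by (auto simp: L_def)
  have chain: "i s + l s \<le> i t" "j s + l s \<le> j t" "p s + l s \<le> p t" if "1 \<le> s" "s < t" for s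
    using chain_le[of t i l s] chain_le[of t j l s] chain_le[of t p l s] d that by auto
  have split: "W = take (b - 1) W @ sub W b q @ drop q (drop (b - 1) W)" for W :: "'a list" and b q
    unfolding sub_def by (metis append_take_drop_id)
  have sp: "s + q \<le> b \<Longrightarrow> valid_sub W s q \<Longrightarrow>
      valid_sub (take (b - 1) W) s q \<and> sub (take (b - 1) W) s q = sub W s q"
    for W :: "'a list" and s q b
    by (rule conjI, rule valid_sub_take, simp, simp, rule sub_take) (auto simp: valid_sub_def)
  show thesis
  proof (rule that)
    show "X = take (i t - 1) X @ L @ drop (l t) (drop (i t - 1) X)"
      using split[of X "i t" "l t"] by (simp add: L_def)
    show "Y = take (j t - 1) Y @ L @ drop (l t) (drop (j t - 1) Y)"
      using split[of Y "j t" "l t"] by (simp only: ct)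
    have "drop (l t) (drop (p t - 1) Z) = []"
      using e t ct(4) by (simp add: valid_sub_def)
    then show "Z = take (p t - 1) Z @ L"
      using split[of Z "p t" "l t"] ct(6) by simp
    show "k \<le> length L"
      using ct(1,2) by (auto simp: L_def sub_def valid_sub_def)
    have 1: "k \<le> l s
          \<and> valid_sub (take (i t - 1) X) (i s) (l s) \<and> valid_sub (take (j t - 1) Y) (j s) (l s)
          \<and> valid_sub (take (p t - 1) Z) (p s) (l s)
          \<and> sub (take (i t - 1) X) (i s) (l s) = sub (take (j t - 1) Y) (j s) (l s)
          \<and> sub (take (j t - 1) Y) (j s) (l s) = sub (take (p t - 1) Z) (p s) (l s)"
      if "s \<in> {1..t-1}" for s
    proof -
      have "1 \<le> s" "s < t" using that by auto
      then show ?thesis using c[of s] chain[of s] by (simp add: sp[simplified])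
    qed
    have 2: "i s + l s \<le> i (s + 1) \<and> j s + l s \<le> j (s + 1) \<and> p (s + 1) = p s + l s"
      if "s \<in> {1..<t-1}" for s using d[of s] that by auto
    have 3: "if t - 1 = 0 then take (p t - 1) Z = []
       else p 1 = 1 \<and> length (take (p t - 1) Z) = p (t - 1) + l (t - 1) - 1"
    proof (cases "t = 1")
      case True
      then show ?thesis using e by simp
    next
      case False
      then have "p t = p (t - 1) + l (t - 1)" using d[of "t - 1"] t by simp
      then show ?thesis using e t False ct(4) by (auto simp: valid_sub_def)
    qed
    show "common_subseq_kplus k (take (i t - 1) X) (take (j t - 1) Y) (take (p t - 1) Z)"
      unfolding common_subseq_kplus_def
      by (rule exI[of _ "t - 1"], rule exI[of _ i], rule exI[of _ j], rule exI[of _ p], rule exI[of _ l])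
        (use 1 2 3 in blast)
  qed
qed

section \<open>The recurrence\<close>

text \<open>
  While \<open>suffix_opt k X Y i j < k\<close>, it is the length of the longest common suffix of the prefixes
  \<open>X[1:i]\<close> and \<open>Y[1:j]\<close>; from \<open>k\<close> on, it is the maximal length of a common subsequence of
  these prefixes whose last block ends at both \<open>i\<close> and \<open>j\<close>. One number can carry both because
  the second quantity is at least \<open>k\<close> whenever it is defined. For \<open>k \<ge> 1\<close>, \<open>i - (k - 1)\<close> is
  \<open>Suc i - k\<close>, written so that the recursion also terminates for \<open>k = 0\<close>.
\<close>

function (sequential) suffix_opt :: "nat \<Rightarrow> 'a list \<Rightarrow> 'a list \<Rightarrow> nat \<Rightarrow> nat \<Rightarrow> nat"
  and prefix_opt :: "nat \<Rightarrow> 'a list \<Rightarrow> 'a list \<Rightarrow> nat \<Rightarrow> nat \<Rightarrow> nat" where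
  "suffix_opt k X Y (Suc i) (Suc j) =
    (if X ! i = Y ! j then
       if Suc (suffix_opt k X Y i j) < k then Suc (suffix_opt k X Y i j)
       else max (Suc (suffix_opt k X Y i j)) (prefix_opt k X Y (i - (k - 1)) (j - (k - 1)) + k)
     else 0)"
| "suffix_opt k X Y i j = 0"
| "prefix_opt k X Y (Suc i) (Suc j) =
    max (max (prefix_opt k X Y i (Suc j)) (prefix_opt k X Y (Suc i) j))
      (if suffix_opt k X Y (Suc i) (Suc j) < k then 0 else suffix_opt k X Y (Suc i) (Suc j))"
| "prefix_opt k X Y i j = 0"
  by pat_completeness auto
termination
  \<comment> \<open>The odd offset ranks \<open>prefix_opt\<close> above \<open>suffix_opt\<close>
    at the same indices, which it calls; every other call decreases \<open>i + j\<close>.\<close>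
  by (relation "measure (\<lambda>x. case x of Inl (k, X, Y, i, j) \<Rightarrow> 2 * (i + j)
      | Inr (k, X, Y, i, j) \<Rightarrow> 2 * (i + j) + 1)") auto

lemma opt_0 [simp]:
  "suffix_opt k X Y i 0 = 0" "prefix_opt k X Y i 0 = 0"
  by (cases i; simp)+

text \<open>In the block branch \<open>k \<le> Suc (suffix_opt k X Y i j)\<close>, so by induction
  \<open>k\<close> is at most \<open>Suc i\<close> and \<open>Suc j\<close>; hence subtracting
  \<open>k - 1\<close> is exact and adding \<open>k\<close> does not exceed these bounds.\<close>

lemma opt_le:
  "suffix_opt k X Y i j \<le> i \<and> suffix_opt k X Y i j \<le> j" "prefix_opt k X Y i j \<le> i \<and> prefix_opt k X Y i j \<le> j"
  by (induction k X Y i j and k X Y i j rule: suffix_opt_prefix_opt.induct) (auto, arith+)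

section \<open>Upper bound: no common subsequence exceeds the recurrence\<close>

lemma prefix_opt_mono:
  assumes "i \<le> i'" "j \<le> j'"
  shows "prefix_opt k X Y i j \<le> prefix_opt k X Y i' j'"
proof -
  have "prefix_opt k X Y i j \<le> prefix_opt k X Y (Suc i) j" for i j by (cases j) (auto simp: le_max_iff_disj)
  then have 1: "prefix_opt k X Y i j \<le> prefix_opt k X Y i' j"
    using lift_Suc_mono_le[of "\<lambda>i. prefix_opt k X Y i j" i i'] assms by blast
  have "prefix_opt k X Y i j \<le> prefix_opt k X Y i (Suc j)" for i j by (cases i) (auto simp: le_max_iff_disj)
  then have 2: "prefix_opt k X Y i' j \<le> prefix_opt k X Y i' j'"
    using lift_Suc_mono_le[of "\<lambda>j. prefix_opt k X Y i' j" j j'] assms by blast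
  show ?thesis using 1 2 by simp
qed

lemma suffix_opt_ge_match:
  assumes "\<And>q. q < l \<Longrightarrow> X ! (i + q) = Y ! (j + q)"
  shows "l \<le> suffix_opt k X Y (i + l) (j + l)"
  using assms
proof (induction l)
  case (Suc l)
  then have "l \<le> suffix_opt k X Y (i + l) (j + l)" "X ! (i + l) = Y ! (j + l)" by auto
  then show ?case by (simp add: le_max_iff_disj)
qed simp

text \<open>The first \<open>k - 1\<close> matches lift \<open>suffix_opt\<close> to at least
  \<open>k - 1\<close>, so the next match opens the branch that adds \<open>k\<close> to
  \<open>prefix_opt\<close> at the start of the block. Each further match contributes one.\<close>

lemma suffix_opt_ge_block:
  assumes "\<And>q. q < l \<Longrightarrow> X ! (i + q) = Y ! (j + q)" and "1 \<le> k" "k \<le> l"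
  shows "prefix_opt k X Y i j + l \<le> suffix_opt k X Y (i + l) (j + l)"
  using assms(3,1)
proof (induction l rule: dec_induct)
  case base
  obtain r where k: "k = Suc r" using assms(2) by (cases k) auto
  have "r \<le> suffix_opt k X Y (i + r) (j + r)" "X ! (i + r) = Y ! (j + r)"
    using suffix_opt_ge_match[of r X i Y j k] base k by auto
  then show ?case by (simp add: k)
next
  case (step l)
  then have "prefix_opt k X Y i j + l \<le> suffix_opt k X Y (i + l) (j + l)" "X ! (i + l) = Y ! (j + l)"
    by auto
  then show ?case using step.hyps by simp
qed

lemma suffix_opt_le_prefix_opt:
  "k \<le> suffix_opt k X Y i j \<Longrightarrow> suffix_opt k X Y i j \<le> prefix_opt k X Y i j"
  by (cases i; cases j) auto

declare suffix_opt.simps(1) [simp del] prefix_opt.simps(1) [simp del]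

text \<open>Strip the last block, bound the rest by induction, and put the block back with
  \<open>suffix_opt_ge_block\<close>; monotonicity absorbs the symbols after it.\<close>

lemma length_le_prefix_opt:
  assumes "1 \<le> k"
  shows "common_subseq_kplus k (take i X) (take j Y) Z \<Longrightarrow> i \<le> length X \<Longrightarrow> j \<le> length Y \<Longrightarrow>
    length Z \<le> prefix_opt k X Y i j"
proof (induction "length Z" arbitrary: Z i j rule: less_induct)
  case less
  show ?case
  proof (cases "Z = []")
    case False
    then obtain X' Y' Z' L A B where
      dec: "take i X = X' @ L @ A" "take j Y = Y' @ L @ B" "Z = Z' @ L" "k \<le> length L"
      and cs: "common_subseq_kplus k X' Y' Z'"
      using common_subseq_kplus_last_block[OF less.prems(1)] by metis
    define a b l where "a = length X'" and "b = length Y'" and "l = length L"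
    have X: "X = X' @ L @ A @ drop i X"
      using append_take_drop_id[of i X] dec(1) by (metis append.assoc)
    have Y: "Y = Y' @ L @ B @ drop j Y"
      using append_take_drop_id[of j Y] dec(2) by (metis append.assoc)
    have "take a X = X'" "take b Y = Y'"
      by (subst X, simp add: a_def, subst Y, simp add: b_def)
    moreover have "a \<le> length X" "b \<le> length Y"
      by (subst X, simp add: a_def, subst Y, simp add: b_def)
    \<comment> \<open>Since \<open>k \<ge> 1\<close>, \<open>L\<close> is nonempty and
      \<open>Z'\<close> is strictly shorter than \<open>Z\<close>.\<close>
    ultimately have 1: "length Z' \<le> prefix_opt k X Y a b"
      using less.hyps[of Z' a b] cs dec(3,4) assms by (cases L) auto
    have "X ! (a + q) = L ! q" "Y ! (b + q) = L ! q" if "q < l" for q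
      using that by (subst X, simp add: a_def l_def nth_append, subst Y, simp add: b_def l_def nth_append)
    then have 2: "prefix_opt k X Y a b + l \<le> suffix_opt k X Y (a + l) (b + l)"
      by (intro suffix_opt_ge_block) (use assms dec in \<open>auto simp: l_def\<close>)
    then have "\<dots> \<le> prefix_opt k X Y (a + l) (b + l)"
      by (intro suffix_opt_le_prefix_opt) (use dec in \<open>simp add: l_def\<close>)
    also have "\<dots> \<le> prefix_opt k X Y i j"
    proof (rule prefix_opt_mono)
      have "length (take i X) = a + l + length A" "length (take j Y) = b + l + length B"
        unfolding dec by (auto simp: a_def b_def l_def)
      then show "a + l \<le> i" "b + l \<le> j" by auto
    qed
    finally show ?thesis using 1 2 dec(3) l_def by simp
  qed simp
qed

section \<open>Attainment of the values of the recurrence\<close>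

lemma take_append_split:
  assumes "take i X = A @ L" "i \<le> length X" "l \<le> length L"
  shows "take i X = take (i - l) X @ drop (length L - l) L"
    "length (drop (length L - l) L) = l"
proof -
  have i: "i = length A + length L" using arg_cong[OF assms(1), of length] assms(2) by simp
  have "take (i - l) X = take (i - l) (take i X)" by (simp add: min_def)
  also have "\<dots> = take (i - l) (A @ L)" by (simp only: assms(1))
  also have "\<dots> = A @ take (length L - l) L" using assms(3) by (simp add: i)
  finally show "take i X = take (i - l) X @ drop (length L - l) L" using assms by simp
  show "length (drop (length L - l) L) = l" using assms by simp
qed

text \<open>Keeping the common suffix \<open>L\<close> apart from the solution \<open>Z\<close>
  before it lets the block grow by one symbol; below \<open>k\<close> there is only a suffix, not
  yet a legal block.\<close>

lemma opt_attained:
  "1 \<le> k \<Longrightarrow> i \<le> length X \<Longrightarrow> j \<le> length Y \<Longrightarrow>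
    \<exists>A B L. take i X = A @ L \<and> take j Y = B @ L \<and>
      (if suffix_opt k X Y i j < k then length L = suffix_opt k X Y i j
       else k \<le> length L \<and> (\<exists>Z. common_subseq_kplus k A B Z \<and> length Z + length L = suffix_opt k X Y i j))"
  "1 \<le> k \<Longrightarrow> i \<le> length X \<Longrightarrow> j \<le> length Y \<Longrightarrow>
    \<exists>Z. common_subseq_kplus k (take i X) (take j Y) Z \<and> length Z = prefix_opt k X Y i j"
proof (induction k X Y i j and k X Y i j rule: suffix_opt_prefix_opt.induct)
  case (1 k X Y i j)
  let ?e = "suffix_opt k X Y i j" and ?e' = "suffix_opt k X Y (Suc i) (Suc j)"
  let ?f = "prefix_opt k X Y (i - (k - 1)) (j - (k - 1))"
  show ?case
  proof (cases "X ! i = Y ! j")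
    case False
    show ?thesis
      by (rule exI[of _ "take (Suc i) X"], rule exI[of _ "take (Suc j) Y"], rule exI[of _ "[]"])
        (use False common_subseq_kplus_Nil in \<open>auto simp: suffix_opt.simps(1)\<close>)
  next
    case True
    obtain A B L where L: "take i X = A @ L" "take j Y = B @ L"
      "if ?e < k then length L = ?e
       else k \<le> length L \<and> (\<exists>Z. common_subseq_kplus k A B Z \<and> length Z + length L = ?e)"
      using "1.IH"(1)[OF True] "1.prems" by auto
    let ?L = "L @ [X ! i]"
    have S: "take (Suc i) X = A @ ?L" "take (Suc j) Y = B @ ?L"
      using "1.prems" L(1,2) True by (simp_all add: take_Suc_conv_app_nth)
    \<comment> \<open>If \<open>Suc ?e\<close> strictly wins the maximum, then
      \<open>?f + k \<le> ?e\<close>, so \<open>?e\<close> has already passed \<open>k\<close> and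
      describes a block that can be extended.\<close>
    consider "Suc ?e < k" | "k \<le> Suc ?e" "?e' = ?f + k" | "k \<le> ?e" "?e' = Suc ?e"
      using True suffix_opt.simps(1)[of k X Y i j] by (cases "Suc ?e < k"; cases "Suc ?e \<le> ?f + k") (auto simp: max_def)
    then show ?thesis
    proof cases
      case 1
      have "?e' = Suc ?e" using 1 True by (simp add: suffix_opt.simps(1))
      show ?thesis
        by (rule exI[of _ A], rule exI[of _ B], rule exI[of _ ?L])
          (use \<open>?e' = Suc ?e\<close> 1 L(3) S in simp)
    next
      case 2
      \<comment> \<open>Either \<open>length L = ?e\<close>, which is at least \<open>k - 1\<close>,
        or \<open>L\<close> alone has length at least \<open>k\<close>.\<close>
      have kL: "k \<le> length ?L" using L(3) 2(1) by (auto split: if_splits)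
      have le: "\<not> Suc ?e < k" "i - (k - 1) \<le> length X" "j - (k - 1) \<le> length Y"
        using 2 "1.prems" by auto
      obtain Z where Z: "common_subseq_kplus k (take (i - (k - 1)) X) (take (j - (k - 1)) Y) Z" "length Z = ?f"
        using "1.IH"(4)[OF True le(1) "1.prems"(1) le(2,3)] by blast
      \<comment> \<open>Only the last \<open>k\<close> symbols of the common suffix form the block;
        the others go back to the prefixes.\<close>
      let ?B = "drop (length ?L - k) ?L"
      have eq: "Suc i - k = i - (k - 1)" "Suc j - k = j - (k - 1)" using "1.prems"(1) by auto
      note B = take_append_split(1)[OF S(1) "1.prems"(2) kL, unfolded eq]
        take_append_split(1)[OF S(2) "1.prems"(3) kL, unfolded eq]
        take_append_split(2)[OF S(1) "1.prems"(2) kL]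
      have e: "k \<le> length ?B" "length Z + length ?B = ?e'" "\<not> ?e' < k" using B(3) Z(2) 2(2) by linarith+
      show ?thesis
        unfolding if_not_P[OF e(3)] using B(1,2) Z(1) e(1,2) by blast
    next
      case 3
      then obtain Z where Z: "k \<le> length L" "common_subseq_kplus k A B Z" "length Z + length L = ?e"
        using L(3) by (metis linorder_not_less)
      have e: "k \<le> length ?L" "length Z + length ?L = ?e'" "\<not> ?e' < k"
        using Z(1,3) 3 length_append_singleton[of L "X ! i"] by linarith+
      show ?thesis
        unfolding if_not_P[OF e(3)] using S Z(2) e(1,2) by blast
    qed
  qed
next
  case (3 k X Y i j)
  let ?e = "suffix_opt k X Y (Suc i) (Suc j)"
  consider "prefix_opt k X Y (Suc i) (Suc j) = prefix_opt k X Y i (Suc j)"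
    | "prefix_opt k X Y (Suc i) (Suc j) = prefix_opt k X Y (Suc i) j"
    | "k \<le> ?e" "prefix_opt k X Y (Suc i) (Suc j) = ?e"
    using prefix_opt.simps(1)[of k X Y i j]
    by (cases "?e < k") (simp_all add: max_def not_less split: if_splits)
  then show ?case
  proof cases
    case 1
    then obtain Z where Z: "common_subseq_kplus k (take i X) (take (Suc j) Y) Z"
      "length Z = prefix_opt k X Y (Suc i) (Suc j)"
      using "3.IH"(1) "3.prems" by auto
    moreover have "take (Suc i) X = take i X @ [X ! i]" using "3.prems" by (simp add: take_Suc_conv_app_nth)
    ultimately show ?thesis using common_subseq_kplus_append[OF Z(1), of "[X ! i]" "[]"] by auto
  next
    case 2
    then obtain Z where Z: "common_subseq_kplus k (take (Suc i) X) (take j Y) Z"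
      "length Z = prefix_opt k X Y (Suc i) (Suc j)"
      using "3.IH"(2) "3.prems" by auto
    moreover have "take (Suc j) Y = take j Y @ [Y ! j]" using "3.prems" by (simp add: take_Suc_conv_app_nth)
    ultimately show ?thesis using common_subseq_kplus_append[OF Z(1), of "[]" "[Y ! j]"] by auto
  next
    case 3
    then obtain A B L Z where "take (Suc i) X = A @ L" "take (Suc j) Y = B @ L" "k \<le> length L"
      "common_subseq_kplus k A B Z" "length Z + length L = ?e"
      using "3.IH"(3) "3.prems" by (auto split: if_splits)
    then show ?thesis using common_subseq_kplus_snoc_block[of k A B Z L] 3
      by (intro exI[of _ "Z @ L"]) simp
  qed
qed (auto intro: common_subseq_kplus_Nil)

lemma prefix_opt_is_LCS:
  assumes "1 \<le> k"
  shows "\<exists>Z. is_LCS_kplus k X Y Z \<and> length Z = prefix_opt k X Y (length X) (length Y)"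
proof -
  obtain Z where "common_subseq_kplus k X Y Z" "length Z = prefix_opt k X Y (length X) (length Y)"
    using opt_attained(2)[OF assms, of "length X" X "length Y" Y] by auto
  moreover have "length Z' \<le> prefix_opt k X Y (length X) (length Y)" if "common_subseq_kplus k X Y Z'" for Z'
    using length_le_prefix_opt[OF assms, of "length X" X "length Y" Y Z'] that by simp
  ultimately show ?thesis
    unfolding is_LCS_kplus_def is_arg_max_def by (metis linorder_not_less)
qed

text \<open>By \<open>opt_le\<close>, \<open>suffix_opt\<close> stays below \<open>k\<close>, so no
  cell passes the threshold. This settles inputs with \<open>length X < k\<close>.\<close>

lemma prefix_opt_eq_0: "i < k \<Longrightarrow> prefix_opt k X Y i j = 0"
proof (induction i arbitrary: j)
  case (Suc i)
  note i = Suc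
  show ?case
  proof (induction j)
    case (Suc j)
    then show ?case
      using i opt_le(1)[of k X Y "Suc i" "Suc j"] by (simp add: prefix_opt.simps(1))
  qed simp
qed simp

section \<open>Runs with a step bound\<close>

text \<open>With an upper bound instead of an exact count, branches of different cost share one
  statement. Since a stuck machine has no successor, a run also certifies that memory and word size
  suffice.\<close>

definition runs ::
  "instr list \<Rightarrow> 'a list \<Rightarrow> 'a list \<Rightarrow> nat \<Rightarrow> nat \<Rightarrow> nat \<Rightarrow> config \<Rightarrow> (config \<Rightarrow> bool) \<Rightarrow> bool" where
  "runs P X Y S W b c Q \<longleftrightarrow> (\<exists>t\<le>b. \<exists>c'. (ram_step P X Y S W ^^ t) c c' \<and> Q c')"

lemma runs_done: "Q c \<Longrightarrow> runs P X Y S W b c Q"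
  unfolding runs_def by (intro exI[of _ 0]) auto

lemma runs_seq:
  assumes "runs P X Y S W b c R" "\<And>c'. R c' \<Longrightarrow> runs P X Y S W b' c' Q"
  shows "runs P X Y S W (b + b') c Q"
proof -
  obtain t c' where t: "t \<le> b" "(ram_step P X Y S W ^^ t) c c'" "R c'"
    using assms(1) unfolding runs_def by blast
  obtain t' c'' where t': "t' \<le> b'" "(ram_step P X Y S W ^^ t') c' c''" "Q c''"
    using assms(2)[OF t(3)] unfolding runs_def by blast
  have "(ram_step P X Y S W ^^ (t + t')) c c''"
    unfolding relpowp_add using t(2) t'(2) by blast
  then show ?thesis unfolding runs_def using t(1) t'(1,3) by (metis add_le_mono)
qed

lemma runs_weaken:
  "runs P X Y S W b c R \<Longrightarrow> b \<le> b' \<Longrightarrow> (\<And>c. R c \<Longrightarrow> Q c) \<Longrightarrow> runs P X Y S W b' c Q"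
  unfolding runs_def by (meson order_trans)

definition bounded :: "nat \<Rightarrow> mem \<Rightarrow> bool" where
  "bounded W M \<longleftrightarrow> (\<forall>a. M a < W)"

lemma bounded_upd: "bounded W M \<Longrightarrow> v < W \<Longrightarrow> bounded W (M(a := v))"
  by (simp add: bounded_def)

lemma runs_step:
  assumes "0 < b" "pc < length P" "P ! pc \<noteq> Halt" "accessed (P ! pc) M \<subseteq> {..<S}"
    "input_in_range X Y (P ! pc) M" "bounded W (snd (exec X Y (P ! pc) pc M))"
    "runs P X Y S W (b - 1) (exec X Y (P ! pc) pc M) Q"
  shows "runs P X Y S W b (pc, M) Q"
proof -
  have "runs P X Y S W 1 (pc, M) (\<lambda>c. c = exec X Y (P ! pc) pc M)"
    unfolding runs_def by (rule exI[of _ 1]) (use assms(2-6) in \<open>auto simp: ram_step_def OO_def bounded_def\<close>)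
  from runs_seq[OF this, of "b - 1" Q] show ?thesis using assms(1,7) by simp
qed

lemma runs_repeat:
  assumes "\<And>i c. i < n \<Longrightarrow> I i c \<Longrightarrow> runs P X Y S W b c (I (Suc i))"
  shows "I 0 c \<Longrightarrow> runs P X Y S W (n * b) c (I n)"
  using assms
proof (induction n)
  case 0
  then show ?case by (simp add: runs_done)
next
  case (Suc n)
  have "runs P X Y S W (n * b + b) c (I (Suc n))"
    by (rule runs_seq[of _ _ _ _ _ _ _ "I n"]) (use Suc in auto)
  then show ?case by (simp add: add.commute)
qed

section \<open>The program\<close>

text \<open>
  Words \<open>0\<close>--\<open>2\<close> hold \<open>k\<close>, \<open>m\<close>, \<open>n\<close>; \<open>3\<close> and \<open>4\<close> the 0-based positions \<open>i\<close> in \<open>X\<close> and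
  \<open>j\<close> in \<open>Y\<close>; \<open>5\<close>, \<open>6\<close>, \<open>7\<close> the addresses of the table rows \<open>j\<close>, \<open>j + 1\<close> and
  \<open>j + 1 - k\<close> (whose slot in the cyclic buffer is that of row \<open>j + 2\<close>); \<open>8\<close> the end of the
  buffer; \<open>9\<close> its size, which is also the offset from the buffer of \<open>prefix_opt\<close> to that of
  \<open>suffix_opt\<close>; \<open>10\<close> and \<open>11\<close> the row length and the constant \<open>1\<close>; \<open>12\<close>--\<open>16\<close> are
  temporary. The buffers start at word \<open>32\<close>. A maximum is computed as \<open>b + (a - b)\<close> with
  truncated subtraction.
\<close>

definition lcs_prog :: "instr list" where
  "lcs_prog = [
    JumpLess 1 0 12,
    Const 11 1, Add 10 1 11, Add 8 0 11, Mult 9 8 10, Const 6 32, Add 7 6 10, Add 8 6 9,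
    JumpLess 4 2 14, Add 12 6 1, Load 0 12, Halt,
    Const 0 0, Halt,
    Move 5 6, Move 6 7, Add 7 7 10, JumpLess 7 8 19, Const 7 32, Const 3 0,
    JumpLess 3 1 23, Add 4 4 11, Jump 8,
    Add 12 5 3, JumpSymEq InX 3 InY 4 28,
    Const 14 0, Const 15 0, Jump 41,
    Add 13 12 9, Load 14 13, Add 14 14 11, Const 15 0, JumpLess 14 0 41,
    Add 15 7 3, Add 15 15 11, Sub 15 15 0, Load 15 15, Add 15 15 0,
    Sub 14 14 15, Add 15 15 14, Move 14 15,
    Add 13 6 3, Load 16 13, Sub 16 16 15, Add 15 15 16,
    Add 12 12 11, Load 16 12, Sub 16 16 15, Add 15 15 16,
    Add 13 13 11, Store 13 15, Add 13 13 9, Store 13 14, Add 3 3 11, Jump 20]"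

lemma length_lcs_prog: "length lcs_prog = 55"
  by (simp add: lcs_prog_def)

lemmas lcs_prog_nth = fun_cong[OF arg_cong[OF lcs_prog_def, of nth]]

text \<open>
  In the symbolic executions below, \<open>runs_step\<close> is iterated until the step bound, which is chosen
  exactly, reaches \<open>0\<close>.
\<close>

lemmas symbolic_step = lcs_prog_nth length_lcs_prog bounded_upd

text \<open>The space bound is 32 words plus two buffers of \<open>k + 1\<close> rows and
  \<open>length X + 1\<close> columns. The row counter reaches \<open>length Y\<close>, which the
  table size does not bound, hence \<open>W_gt\<close>.\<close>

locale lcs_ram =
  fixes k :: nat and X Y :: "'a list" and S W :: nat
  assumes k1: "1 \<le> k" and kX: "k \<le> length X"
    and S_ge: "32 + 2 * ((k + 1) * (length X + 1)) \<le> S"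
    and W_ge: "32 + 2 * ((k + 1) * (length X + 1)) \<le> W" and W_gt: "length Y < W"
begin

abbreviation "m \<equiv> length X"
abbreviation "n \<equiv> length Y"
abbreviation "E \<equiv> suffix_opt k X Y"
abbreviation "F \<equiv> prefix_opt k X Y"

section \<open>Cyclic buffer layout and loop invariants\<close>

definition N :: nat where "N = (k + 1) * (m + 1)"
definition base :: "nat \<Rightarrow> nat" where "base r = 32 + (r mod (k + 1)) * (m + 1)"

text \<open>
  The state of the buffers when rows up to \<open>j\<close> and the cells up to column \<open>i\<close> of row \<open>j + 1\<close>
  have been computed. Column \<open>0\<close> is never written and stays \<open>0\<close> for every row.
\<close>

definition stored :: "nat \<Rightarrow> nat \<Rightarrow> mem \<Rightarrow> bool" where
  "stored j i M \<longleftrightarrow> (\<forall>r q. q \<le> m \<and> (r \<le> j \<and> j < r + k \<or> r = Suc j \<and> q \<le> i \<or> q = 0) \<longrightarrow>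
     M (base r + q) = F q r \<and> M (base r + q + N) = E q r)"

definition regs :: "nat \<Rightarrow> mem \<Rightarrow> bool" where
  "regs j M \<longleftrightarrow> M 0 = k \<and> M 1 = m \<and> M 2 = n \<and> M 4 = j \<and> M 8 = 32 + N \<and> M 9 = N \<and>
    M 10 = m + 1 \<and> M 11 = 1 \<and> bounded W M"

text \<open>Invariant at the head of the outer loop, instruction 8; \<open>in_row\<close> is that of
  the inner loop, instruction 20. In between, the row pointers are rotated by one row.\<close>

definition row_start :: "nat \<Rightarrow> config \<Rightarrow> bool" where
  "row_start j c \<longleftrightarrow> (\<exists>M. c = (8, M) \<and> regs j M \<and> stored j 0 M \<and> M 6 = base j \<and> M 7 = base (Suc j))"

definition in_row :: "nat \<Rightarrow> nat \<Rightarrow> config \<Rightarrow> bool" where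
  "in_row j i c \<longleftrightarrow> (\<exists>M. c = (20, M) \<and> regs j M \<and> stored j i M \<and> M 3 = i \<and> M 5 = base j \<and>
     M 6 = base (Suc j) \<and> M 7 = base (Suc (Suc j)))"

lemma SW_ge: "32 + 2 * N \<le> S" "32 + 2 * N \<le> W"
  using S_ge W_ge by (simp_all add: N_def)

lemma N_gt: "2 * m < N" "m + k < N"
proof -
  have "2 * (m + 1) \<le> N" unfolding N_def by (rule mult_le_mono1) (use k1 in simp)
  then show "2 * m < N" "m + k < N" using kX by auto
qed

lemma base_less: "q \<le> m \<Longrightarrow> base r + q < 32 + N"
proof -
  assume "q \<le> m"
  have "r mod (k + 1) \<le> k" by (simp add: less_Suc_eq_le[symmetric])
  then have "(r mod (k + 1)) * (m + 1) \<le> k * (m + 1)" by (rule mult_le_mono1)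
  then show ?thesis using \<open>q \<le> m\<close> by (simp add: base_def N_def)
qed

lemma base_ge: "32 \<le> base r" by (simp add: base_def)

text \<open>Lets the program advance a row address by an addition and a comparison, as the machine
  has no modulo instruction.\<close>

lemma base_Suc: "base (Suc r) = (if base r + (m + 1) < 32 + N then base r + (m + 1) else 32)"
proof (cases "Suc (r mod (k + 1)) = k + 1")
  case True
  then have r: "r mod (k + 1) = k" by simp
  then have "Suc r mod (k + 1) = 0" using mod_Suc[of r "k + 1"] by simp
  then show ?thesis using r by (simp add: base_def N_def)
next
  case False
  then have "Suc r mod (k + 1) = Suc (r mod (k + 1))" using mod_Suc[of r "k + 1"] by simp
  then have 1: "base (Suc r) = base r + (m + 1)" by (simp add: base_def)
  show ?thesis using 1 base_less[of 0 "Suc r"] by simp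
qed

text \<open>Columns are below \<open>m + 1\<close>, so column and slot are remainder and quotient of
  the offset by \<open>m + 1\<close>.\<close>

lemma base_inj:
  assumes "base r + q = base r' + q'" "q \<le> m" "q' \<le> m"
  shows "q = q' \<and> r mod (k + 1) = r' mod (k + 1)"
proof -
  let ?a = "r mod (k + 1)" and ?b = "r' mod (k + 1)"
  have *: "?a * (m + 1) + q = ?b * (m + 1) + q'" using assms(1) by (simp add: base_def)
  have "(?a * (m + 1) + q) mod (m + 1) = q" "(?b * (m + 1) + q') mod (m + 1) = q'"
    using assms(2,3) by (simp_all only: mod_mult_self3) simp_all
  then have "q = q'" using * by metis
  then have "?a * (m + 1) = ?b * (m + 1)" using * by simp
  then show ?thesis using \<open>q = q'\<close> unfolding mult_cancel2 by simp
qed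

text \<open>The difference \<open>Suc j - r\<close> lies between \<open>1\<close> and
  \<open>k\<close>, so \<open>k + 1\<close> cannot divide it.\<close>

lemma base_neq_window:
  assumes "r \<le> j" "j < r + k"
  shows "r mod (k + 1) \<noteq> Suc j mod (k + 1)"
proof
  assume "r mod (k + 1) = Suc j mod (k + 1)"
  then have "(k + 1) dvd (Suc j - r)" using assms(1) by (metis mod_eq_dvd_iff_nat le_SucI)
  then show False using assms by (auto dest!: dvd_imp_le)
qed

text \<open>A clash with another recorded cell would force column \<open>Suc i\<close>, which is not
  the zero column, and the slot of row \<open>Suc j\<close>, which no row of the window
  shares.\<close>

lemma stored_update:
  assumes "stored j i M" "i < m"
    and M': "M' (base (Suc j) + Suc i) = F (Suc i) (Suc j)"
      "M' (base (Suc j) + Suc i + N) = E (Suc i) (Suc j)"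
    and other: "\<And>a. 32 \<le> a \<Longrightarrow> a \<noteq> base (Suc j) + Suc i \<Longrightarrow> a \<noteq> base (Suc j) + Suc i + N \<Longrightarrow> M' a = M a"
  shows "stored j (Suc i) M'"
  unfolding stored_def
proof (intro allI impI)
  fix r q
  assume rq: "q \<le> m \<and> (r \<le> j \<and> j < r + k \<or> r = Suc j \<and> q \<le> Suc i \<or> q = 0)"
  show "M' (base r + q) = F q r \<and> M' (base r + q + N) = E q r"
  proof (cases "r = Suc j \<and> q = Suc i")
    case True
    then show ?thesis using M' by simp
  next
    case False
    have ne: "base r + q \<noteq> base (Suc j) + Suc i"
    proof
      assume "base r + q = base (Suc j) + Suc i"
      then have "q = Suc i" "r mod (k + 1) = Suc j mod (k + 1)"
        using base_inj[of r q "Suc j" "Suc i"] rq assms(2) by auto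
      then show False using rq False base_neq_window[of r j] by auto
    qed
    have lt: "base r + q < 32 + N" "base (Suc j) + Suc i < 32 + N" "32 \<le> base r" "32 \<le> base (Suc j)"
      using base_less[of q r] base_less[of "Suc i" "Suc j"] base_ge rq assms(2) by auto
    have "M' (base r + q) = M (base r + q)" "M' (base r + q + N) = M (base r + q + N)"
      by (rule other; use ne lt in linarith)+
    then show ?thesis using assms(1) rq False unfolding stored_def by auto
  qed
qed

text \<open>The completed row enters the window and the oldest one leaves it.\<close>

lemma stored_next_row: "stored j m M \<Longrightarrow> stored (Suc j) 0 M"
  unfolding stored_def by (metis Suc_lessD le_SucE le_zero_eq)

section \<open>Execution of one table cell\<close>

lemma finish_cell:
  assumes regs: "M 6 = c" "M 3 = i" "M 9 = N" "M 11 = 1" "M 12 = a" "M 14 = e" "M 15 = g"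
    and vals: "M (c + i) = f" "M (a + 1) = f'"
    and mem: "bounded W M" "32 \<le> c" "32 \<le> a" "a + 1 < S" "a + 1 < W" "c + i + 1 + N < S" "c + i + 1 + N < W"
    and bounds: "f < W" "f' < W" "g < W" "e < W"
  shows "runs lcs_prog X Y S W 14 (41, M) (\<lambda>c'. \<exists>M'. c' = (20, M') \<and>
    M' (c + i + 1) = max (max f f') g \<and> M' (c + i + 1 + N) = e \<and> M' 3 = i + 1 \<and> bounded W M' \<and>
    (\<forall>x. x \<noteq> 3 \<and> (x < 12 \<or> 32 \<le> x \<and> x \<noteq> c + i + 1 \<and> x \<noteq> c + i + 1 + N) \<longrightarrow> M' x = M x))"
proof -
  have S: "32 < S" "0 < N" using mem N_gt by simp_all
  \<comment> \<open>The two truncated-subtraction maxima: \<open>h\<close> is the maximum of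
    \<open>f\<close> and \<open>g\<close>, and \<open>h'\<close> that of \<open>f'\<close> and
    \<open>h\<close>. Names keep the symbolic execution free of nested subtractions.\<close>
  obtain d h d' h' where d: "f - g = d" "g + d = h" "f' - h = d'" "h + d' = h'" by blast
  have h: "h < W" "h' < W" "d < W" "d' < W" "max (max f f') g = h'"
    using bounds d by auto
  show ?thesis
    unfolding h
    by (insert regs vals mem bounds S d h(1-4),
        (rule runs_step, (simp add: symbolic_step; fail)+, simp add: lcs_prog_nth)+,
        rule runs_done, simp add: bounded_upd)
qed

text \<open>The three branches of \<open>suffix_opt\<close> take 5, 7 and 15 steps and meet at
  instruction 41. The old row is read only in the last one, so its content is assumed only under
  that guard.\<close>

lemma begin_cell:
  assumes regs: "M 0 = k" "M 3 = i" "M 4 = j" "M 5 = c" "M 7 = c'" "M 9 = N" "M 11 = 1"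
    and ij: "i < m" "j < n"
    and vals: "M (c + i + N) = E i j" "k \<le> Suc (E i j) \<Longrightarrow> M (c' + Suc i - k) = F (i - (k - 1)) (j - (k - 1))"
    and mem: "bounded W M" "32 \<le> c" "c + i < 32 + N" "32 \<le> c'" "c' + Suc i < 32 + N"
  shows "runs lcs_prog X Y S W 15 (23, M) (\<lambda>s. \<exists>M'. s = (41, M') \<and>
    M' 12 = c + i \<and> M' 14 = E (Suc i) (Suc j) \<and>
    M' 15 = (if E (Suc i) (Suc j) < k then 0 else E (Suc i) (Suc j)) \<and> bounded W M' \<and>
    (\<forall>x. x < 12 \<or> 32 \<le> x \<longrightarrow> M' x = M x))" (is "runs _ _ _ _ _ _ _ ?Q")
proof -
  define e f where "e = E i j" and "f = F (i - (k - 1)) (j - (k - 1))"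
  note SW = SW_ge
  have e: "e \<le> i" using opt_le(1)[of k X Y i j] by (simp add: e_def)
  have f: "f \<le> i" unfolding f_def by (rule le_trans[OF conjunct1[OF opt_le(2)] diff_le_self])
  have v1: "M (c + i + N) = e" using vals by (simp add: e_def)
  have b: "c + i < W" "c + i + N < W" "c + i + N < S" "Suc e < W" "32 < S" "0 < W"
    using mem SW ij N_gt e by linarith+
  consider "X ! i \<noteq> Y ! j" | "X ! i = Y ! j" "Suc e < k" | "X ! i = Y ! j" "\<not> Suc e < k" by blast
  then show ?thesis
  proof cases
    case 1
    have *: "E (Suc i) (Suc j) = 0" using 1 by (simp add: suffix_opt.simps(1))
    have "runs lcs_prog X Y S W 5 (23, M) ?Q"
      unfolding *
      by (insert regs ij mem b k1 1,
          (rule runs_step, (simp add: symbolic_step; fail)+, simp add: lcs_prog_nth)+,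
          rule runs_done, simp add: bounded_upd)
    then show ?thesis by (rule runs_weaken) auto
  next
    case 2
    have *: "E (Suc i) (Suc j) = Suc e" using 2 by (simp add: e_def suffix_opt.simps(1))
    have "runs lcs_prog X Y S W 7 (23, M) ?Q"
      unfolding *
      by (insert regs ij mem b k1 2 v1,
          (rule runs_step, (simp add: symbolic_step; fail)+, simp add: lcs_prog_nth)+,
          rule runs_done, simp add: bounded_upd)
    then show ?thesis by (rule runs_weaken) auto
  next
    case 3
    have v2: "M (Suc (c' + i) - k) = f" using vals(2) 3 by (simp add: f_def e_def)
    obtain d h a where d: "Suc e - (f + k) = d" "f + k + d = h" "Suc (c' + i) - k = a" by blast
    have "E (Suc i) (Suc j) = max (Suc e) (f + k)" using 3 by (simp add: e_def f_def suffix_opt.simps(1))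
    then have *: "E (Suc i) (Suc j) = h" using d(1,2) by (simp add: max_def split: if_splits)
    \<comment> \<open>Here \<open>k \<le> Suc e \<le> Suc i\<close>, so the address \<open>a\<close>
      does not fall below \<open>c'\<close> and stays clear of the registers.\<close>
    have h: "d < W" "h < W" "f + k < W" "f < W" "a < W" "a < S" "c' + i < W" "Suc (c' + i) < W" "\<not> h < k" "32 \<le> a"
      using 3(2) d mem SW ij N_gt e f kX by linarith+
    have "runs lcs_prog X Y S W 15 (23, M) ?Q"
      unfolding *
      by (insert regs ij mem b 3 v1 v2[unfolded d(3)] d h,
          (rule runs_step, (simp add: symbolic_step; fail)+, simp add: lcs_prog_nth)+,
          rule runs_done, simp add: bounded_upd)
    then show ?thesis by (rule runs_weaken) auto
  qed
qed

text \<open>The row numbers differ by \<open>k + 1\<close>, so one address serves to read the old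
  row now and to write the next row later.\<close>

lemma base_window: "k \<le> Suc j \<Longrightarrow> base (Suc j - k) = base (Suc (Suc j))"
proof -
  assume "k \<le> Suc j"
  then have "Suc (Suc j) = (Suc j - k) + (k + 1)" by simp
  then show ?thesis by (metis base_def mod_add_self2)
qed

lemma stored_cong:
  assumes "stored j i M" "\<And>x. 32 \<le> x \<Longrightarrow> M' x = M x"
  shows "stored j i M'"
proof -
  have "M' (base r + q) = M (base r + q)" "M' (base r + q + N) = M (base r + q + N)" for r q
    using base_ge[of r] by (auto intro!: assms(2))
  then show ?thesis using assms(1) by (simp add: stored_def)
qed

lemma cell:
  assumes "in_row j i c" "i < m" "j < n"
  shows "runs lcs_prog X Y S W 30 c (in_row j (Suc i))"
proof -
  obtain M where c: "c = (20, M)" and M: "regs j M" "stored j i M" "M 3 = i" "M 5 = base j"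
    "M 6 = base (Suc j)" "M 7 = base (Suc (Suc j))"
    using assms(1) unfolding in_row_def by blast
  have R: "M 0 = k" "M 1 = m" "M 4 = j" "M 9 = N" "M 11 = 1" "bounded W M"
    using M(1) by (simp_all add: regs_def)
  have st: "M (base r + q) = F q r" "M (base r + q + N) = E q r"
    if "q \<le> m" "r \<le> j \<and> j < r + k \<or> r = Suc j \<and> q \<le> i \<or> q = 0" for r q
    using M(2) that unfolding stored_def by blast+
  have e: "E i j \<le> i" "E i j \<le> j" using opt_le(1)[of k X Y i j] by auto
  have step: "runs lcs_prog X Y S W 1 (20, M) (\<lambda>s. s = (23, M))"
    by (rule runs_step) (use SW_ge R M(3) assms in \<open>auto simp: lcs_prog_nth length_lcs_prog intro: runs_done\<close>)
  \<comment> \<open>Row \<open>Suc j - k\<close> is the oldest one in the window;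
    \<open>opt_le\<close> and the guard make both subtractions of \<open>k\<close> exact.\<close>
  have old: "M (base (Suc (Suc j)) + Suc i - k) = F (i - (k - 1)) (j - (k - 1))" if "k \<le> Suc (E i j)"
  proof -
    have kj: "k \<le> Suc j" "k \<le> Suc i" using that e by linarith+
    have "base (Suc (Suc j)) + Suc i - k = base (Suc j - k) + (Suc i - k)"
      unfolding base_window[OF kj(1)] using kj(2) by (rule diff_add_assoc)
    also have "M \<dots> = F (Suc i - k) (Suc j - k)"
      by (rule st) (use kj assms k1 in auto)
    also have "Suc i - k = i - (k - 1)" using k1 by simp
    also have "Suc j - k = j - (k - 1)" using k1 by simp
    finally show ?thesis .
  qed
  have lt: "base j + i < 32 + N" "base j + Suc i < 32 + N" "base (Suc j) + Suc i < 32 + N" "base (Suc (Suc j)) + Suc i < 32 + N"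
    by ((rule base_less; use assms in simp)+)
  have first_half: "runs lcs_prog X Y S W 15 (23, M) (\<lambda>s. \<exists>M'. s = (41, M') \<and>
    M' 12 = base j + i \<and> M' 14 = E (Suc i) (Suc j) \<and>
    M' 15 = (if E (Suc i) (Suc j) < k then 0 else E (Suc i) (Suc j)) \<and> bounded W M' \<and>
    (\<forall>x. x < 12 \<or> 32 \<le> x \<longrightarrow> M' x = M x))" (is "runs _ _ _ _ _ _ _ ?R")
    by (rule begin_cell[OF R(1) M(3) R(3) M(4) M(6) R(4,5) assms(2,3) st(2) old R(6)
          base_ge lt(1) base_ge lt(4)]) (use assms k1 in auto)
  have second_half: "runs lcs_prog X Y S W 14 s (in_row j (Suc i))" if begun: "?R s" for s
  proof -
    obtain M' where s: "s = (41, M')" and M': "M' 12 = base j + i" "M' 14 = E (Suc i) (Suc j)"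
      "M' 15 = (if E (Suc i) (Suc j) < k then 0 else E (Suc i) (Suc j))" "bounded W M'"
      and same: "\<And>x. x < 12 \<or> 32 \<le> x \<Longrightarrow> M' x = M x"
      using begun by blast
    let ?a = "base (Suc j) + i + 1"
    have E: "E (Suc i) (Suc j) \<le> m" using opt_le(1)[of k X Y "Suc i" "Suc j"] assms(2) by simp
    have F: "F i (Suc j) \<le> m" "F (Suc i) j \<le> m"
      using opt_le(2)[of k X Y i "Suc j"] opt_le(2)[of k X Y "Suc i" j] assms(2) by simp_all
    have "runs lcs_prog X Y S W 14 (41, M') (\<lambda>c'. \<exists>M''. c' = (20, M'') \<and>
      M'' ?a = max (max (F i (Suc j)) (F (Suc i) j)) (if E (Suc i) (Suc j) < k then 0 else E (Suc i) (Suc j))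
      \<and> M'' (?a + N) = E (Suc i) (Suc j) \<and> M'' 3 = i + 1 \<and> bounded W M'' \<and>
      (\<forall>x. x \<noteq> 3 \<and> (x < 12 \<or> 32 \<le> x \<and> x \<noteq> ?a \<and> x \<noteq> ?a + N) \<longrightarrow> M'' x = M' x))"
    proof (rule finish_cell)
      show "M' (base (Suc j) + i) = F i (Suc j)" "M' (base j + i + 1) = F (Suc i) j"
        using st(1)[of i "Suc j"] st(1)[of "Suc i" j] same base_ge[of j] base_ge[of "Suc j"] assms k1
        by (auto simp: trans_le_add1)
      show "M' 6 = base (Suc j)" "M' 3 = i" "M' 9 = N" "M' 11 = 1" using same M R by simp_all
      show "base j + i + 1 < S" "base j + i + 1 < W" "base (Suc j) + i + 1 + N < S"
        "base (Suc j) + i + 1 + N < W" "F i (Suc j) < W" "F (Suc i) j < W" "E (Suc i) (Suc j) < W"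
        "(if E (Suc i) (Suc j) < k then 0 else E (Suc i) (Suc j)) < W"
        "32 \<le> base j + i"
        using lt SW_ge E F N_gt base_ge[of j] by auto
    qed (use M' base_ge in auto)
    then show ?thesis unfolding s
    proof (rule runs_weaken)
      fix c' :: config
      assume "\<exists>M''. c' = (20, M'') \<and>
        M'' ?a = max (max (F i (Suc j)) (F (Suc i) j)) (if E (Suc i) (Suc j) < k then 0 else E (Suc i) (Suc j))
        \<and> M'' (?a + N) = E (Suc i) (Suc j) \<and> M'' 3 = i + 1 \<and> bounded W M'' \<and>
        (\<forall>x. x \<noteq> 3 \<and> (x < 12 \<or> 32 \<le> x \<and> x \<noteq> ?a \<and> x \<noteq> ?a + N) \<longrightarrow> M'' x = M' x)"
      then obtain M'' where c': "c' = (20, M'')" and v: "M'' ?a = F (Suc i) (Suc j)"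
        "M'' (?a + N) = E (Suc i) (Suc j)" "M'' 3 = i + 1" "bounded W M''"
        and same'': "\<And>x. x \<noteq> 3 \<Longrightarrow> x < 12 \<or> 32 \<le> x \<and> x \<noteq> ?a \<and> x \<noteq> ?a + N \<Longrightarrow> M'' x = M' x"
        unfolding prefix_opt.simps(1)[symmetric] by blast
      have "stored j (Suc i) M''"
        by (rule stored_update[OF M(2) assms(2)]) (use v same same'' in auto)
      moreover have "regs j M''" using M(1) v(4) same same'' by (simp add: regs_def)
      ultimately show "in_row j (Suc i) c'"
        unfolding in_row_def c' using v M same same'' by simp
    qed simp
  qed
  have "runs lcs_prog X Y S W (1 + (15 + 14)) c (in_row j (Suc i))"
    unfolding c by (rule runs_seq[OF step], erule ssubst, rule runs_seq[OF first_half], erule second_half)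
  then show ?thesis by simp
qed

section \<open>Whole rows, initialisation and output\<close>

lemma row:
  assumes "row_start j c" "j < n"
  shows "runs lcs_prog X Y S W (10 + m * 30) c (row_start (Suc j))"
proof -
  obtain M where c: "c = (8, M)" and M: "regs j M" "stored j 0 M" "M 6 = base j" "M 7 = base (Suc j)"
    using assms(1) unfolding row_start_def by blast
  have R: "M 0 = k" "M 1 = m" "M 2 = n" "M 4 = j" "M 8 = 32 + N" "M 9 = N" "M 10 = Suc m" "M 11 = 1" "bounded W M"
    using M(1) by (simp_all add: regs_def)
  obtain b b' where b: "base j = b" "base (Suc j) = b'" by blast
  have lt: "b + m < 32 + N" "b' + m < 32 + N"
    using base_less[of m j] base_less[of m "Suc j"] b by auto
  have facts: "b < W" "b' < W" "Suc (b' + m) < W" "32 < W" "32 < S" "32 \<le> b" "32 \<le> b'"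
    using lt SW_ge b base_ge[of j] base_ge[of "Suc j"] N_gt by linarith+
  have st: "stored j 0 M'" if "\<And>x. 32 \<le> x \<Longrightarrow> M' x = M x" for M'
    using stored_cong[OF M(2) that] .
  \<comment> \<open>The only difference between the cases is whether the address in word
    \<open>7\<close> wraps around, which costs one more step.\<close>
  have enter: "runs lcs_prog X Y S W 7 (8, M) (in_row j 0)"
  proof (cases "Suc (b' + m) < 32 + N")
    case True
    have bs: "base (Suc (Suc j)) = Suc (b' + m)" using base_Suc[of "Suc j"] b True by simp
    have "runs lcs_prog X Y S W 6 (8, M) (in_row j 0)"
      by (insert R M(3,4)[unfolded b] assms(2) facts True,
          (rule runs_step, (simp add: symbolic_step; fail)+, simp add: lcs_prog_nth)+,
          rule runs_done, simp add: in_row_def regs_def b bs bounded_upd st)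
    then show ?thesis by (rule runs_weaken) auto
  next
    case False
    have bs: "base (Suc (Suc j)) = 32" using base_Suc[of "Suc j"] b False by simp
    show ?thesis
      by (insert R M(3,4)[unfolded b] assms(2) facts False,
          (rule runs_step, (simp add: symbolic_step; fail)+, simp add: lcs_prog_nth)+,
          rule runs_done, simp add: in_row_def regs_def b bs bounded_upd st)
  qed
  have leave: "runs lcs_prog X Y S W 3 s (row_start (Suc j))" if end_row: "in_row j m s" for s
  proof -
    obtain M where s: "s = (20, M)" and M: "regs j M" "stored j m M" "M 3 = m"
      "M 6 = base (Suc j)" "M 7 = base (Suc (Suc j))"
      using end_row unfolding in_row_def by blast
    have R: "M 0 = k" "M 1 = m" "M 2 = n" "M 4 = j" "M 8 = 32 + N" "M 9 = N" "M 10 = Suc m" "M 11 = 1" "bounded W M"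
      using M(1) by (simp_all add: regs_def)
    have stored: "stored (Suc j) 0 (M(4 := Suc j))"
      by (rule stored_cong[OF stored_next_row[OF M(2)]]) simp
    have jW: "Suc j < W" using assms(2) W_gt by simp
    show ?thesis
      unfolding s
      by (insert R M(3-) facts jW,
          (rule runs_step, (simp add: symbolic_step; fail)+, simp add: lcs_prog_nth)+,
          rule runs_done, simp add: row_start_def regs_def bounded_upd stored)
  qed
  have "runs lcs_prog X Y S W (7 + (m * 30 + 3)) c (row_start (Suc j))"
    unfolding c
    by (rule runs_seq[OF enter], rule runs_seq[OF runs_repeat[where I = "in_row j"]])
      (use cell assms(2) leave in auto)
  then show ?thesis by (simp add: add.commute add.left_commute)
qed

lemma prologue: "runs lcs_prog X Y S W 8 (0, init_mem k m n) (row_start 0)"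
proof -
  have b: "base 0 = 32" by (simp add: base_def)
  have b1: "base (Suc 0) = Suc (32 + m)"
    using k1 by (simp add: base_def)
  have facts: "32 < W" "32 < S" "Suc m < W" "Suc k < W" "N < W" "32 + N < W" "Suc (32 + m) < W" "k < W"
    "m < W" "n < W" "\<not> m < k" "Suc (k + (m + k * m)) = N"
    using SW_ge N_gt kX W_gt by (auto simp: N_def)
  define M where "M = init_mem k m n"
  have M: "M 0 = k" "M 1 = m" "M 2 = n" "M 4 = 0" "bounded W M" "\<And>x. 32 \<le> x \<Longrightarrow> M x = 0"
    using facts by (auto simp: M_def init_mem_def bounded_def)
  \<comment> \<open>Zeroed memory already represents row \<open>0\<close> and column
    \<open>0\<close>, where both functions vanish.\<close>
  have st: "stored 0 0 M'" if "\<And>x. 32 \<le> x \<Longrightarrow> M' x = M x" for M'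
  proof -
    have "M' (base r + q) = 0" "M' (base r + q + N) = 0" for r q
      using that M(6) base_ge[of r] by (simp_all add: trans_le_add1)
    then show ?thesis by (auto simp: stored_def)
  qed
  show ?thesis
    unfolding M_def[symmetric]
    by (insert M(1-5) facts,
        (rule runs_step, (simp add: symbolic_step; fail)+, simp add: lcs_prog_nth)+,
        rule runs_done, simp add: row_start_def regs_def bounded_upd st b b1)
qed

lemma epilogue:
  assumes "row_start n c"
  shows "runs lcs_prog X Y S W 3 c (\<lambda>s. \<exists>M. s = (11, M) \<and> M 0 = F m n)"
proof -
  obtain M where c: "c = (8, M)" and M: "regs n M" "stored n 0 M" "M 6 = base n"
    using assms(1) unfolding row_start_def by blast
  have R: "M 1 = m" "M 2 = n" "M 4 = n" "bounded W M"
    using M(1) by (simp_all add: regs_def)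
  have v: "M (base n + m) = F m n" using M(2) k1 by (auto simp: stored_def)
  have facts: "base n + m < S" "base n + m < W" "32 < S" "32 \<le> base n" "F m n < W"
    using base_less[of m n] SW_ge N_gt base_ge[of n] opt_le(2)[of k X Y m n] by linarith+
  show ?thesis
    unfolding c
    by (insert R M(3) v facts,
        (rule runs_step, (simp add: symbolic_step; fail)+, simp add: lcs_prog_nth)+,
        rule runs_done, simp)
qed

lemma lcs_prog_runs:
  "runs lcs_prog X Y S W (8 + (n * (10 + m * 30) + 3)) (0, init_mem k m n)
    (\<lambda>s. \<exists>M. s = (11, M) \<and> M 0 = F m n)"
  by (rule runs_seq[OF prologue], rule runs_seq[OF runs_repeat[where I = row_start]])
    (use row epilogue in auto)

end

section \<open>Time, space and word-size bounds\<close>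

lemma runs_imp_ram_computes:
  assumes "runs P X Y S W b (0, init_mem k (length X) (length Y))
      (\<lambda>s. \<exists>pc M. s = (pc, M) \<and> pc < length P \<and> P ! pc = Halt \<and> M 0 = r)"
  shows "\<exists>t\<le>b. ram_computes P k X Y S W t r"
  using assms unfolding runs_def ram_computes_def by blast

lemma lcs_prog_correct:
  assumes k: "1 \<le> k" and XY: "length X \<le> length Y"
  defines "m \<equiv> length X" and "n \<equiv> length Y"
  shows "\<exists>t\<le>51 * (m * n + 1).
    ram_computes lcs_prog k X Y (64 * (k * m + 1)) ((m + n + k + 2) ^ 4) t (prefix_opt k X Y m n)"
proof -
  define S W where "S = 64 * (k * m + 1)" and "W = (m + n + k + 2) ^ 4"
  have W1: "m + n + k + 2 \<le> W"
    unfolding W_def using power_increasing[of 1 4 "m + n + k + 2"] by simp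
  have "runs lcs_prog X Y S W (51 * (m * n + 1)) (0, init_mem k m n)
      (\<lambda>s. \<exists>pc M. s = (pc, M) \<and> pc < length lcs_prog \<and> lcs_prog ! pc = Halt \<and> M 0 = prefix_opt k X Y m n)"
    (is "runs _ _ _ _ _ _ _ ?Q")
  proof (cases "m < k")
    \<comment> \<open>The program jumps to instruction 12 and outputs \<open>0\<close> after two
      steps. With \<open>m = 0\<close> the product \<open>m * n\<close> vanishes, so the
      \<open>+ 1\<close> in the bound pays for them.\<close>
    case True
    define M where "M = init_mem k m n"
    have M: "M 0 = k" "M 1 = m" "bounded W M"
      using W1 by (auto simp: M_def init_mem_def bounded_def)
    have facts: "0 < W" "32 < S" using W1 by (auto simp: S_def)
    have "runs lcs_prog X Y S W 2 (0, M) ?Q"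
      by (insert M facts True,
          (rule runs_step, (simp add: symbolic_step; fail)+, simp add: lcs_prog_nth)+,
          rule runs_done, simp add: prefix_opt_eq_0 lcs_prog_nth length_lcs_prog)
    then show ?thesis unfolding M_def by (rule runs_weaken) auto
  next
    case False
    then have m: "1 \<le> m" "k \<le> m" and n: "1 \<le> n" using k XY by (auto simp: m_def n_def)
    have km: "k \<le> k * m" "m \<le> k * m" "n \<le> m * n" using k m by auto
    have "(k + 1) * (m + 1) = k * m + k + m + 1" by simp
    \<comment> \<open>With \<open>p = k * m\<close> the left side is at most
      \<open>6 * p + 34\<close>.\<close>
    moreover have "32 + 2 * (p + k + m + 1) \<le> 64 * (p + 1)" if "k \<le> p" "m \<le> p" for p
      using that by simp
    then have "32 + 2 * (k * m + k + m + 1) \<le> S" unfolding S_def using km(1,2) .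
    ultimately have S: "32 + 2 * ((k + 1) * (m + 1)) \<le> S" by (simp only:)
    have W: "32 + 2 * ((k + 1) * (m + 1)) \<le> W"
    proof -
      define s where "s = m + n + k + 2"
      \<comment> \<open>As \<open>k\<close>, \<open>m\<close>, \<open>n\<close> are positive,
        \<open>s \<ge> 5\<close>; then \<open>W = s ^ 4\<close> is at least
        \<open>25 * s ^ 2\<close>, which exceeds \<open>32 + 2 * s ^ 2\<close>.\<close>
      have "5 * 5 \<le> s * s" by (rule mult_le_mono) (use k m n in \<open>simp_all add: s_def\<close>)
      then have "25 * (s * s) \<le> (s * s) * (s * s)" by (intro mult_le_mono1) simp
      moreover have "(k + 1) * (m + 1) \<le> s * s" by (rule mult_le_mono) (simp_all add: s_def)
      moreover have "W = (s * s) * (s * s)" by (simp only: W_def s_def[symmetric] power4_eq_xxxx mult.assoc)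
      ultimately show ?thesis using \<open>5 * 5 \<le> s * s\<close> by linarith
    qed
    interpret lcs_ram k X Y S W
      by unfold_locales (use k False S W W1 in \<open>auto simp: m_def n_def\<close>)
    \<comment> \<open>Since \<open>n \<le> m * n\<close>, the total cost is at most
      \<open>40 * (m * n) + 11\<close>.\<close>
    have "8 + (10 * n + 30 * p + 3) \<le> 51 * (p + 1)" if "n \<le> p" for p
      using that by simp
    from this[OF km(3)] have "8 + (10 * n + 30 * (m * n) + 3) \<le> 51 * (m * n + 1)" .
    moreover have "n * (10 + m * 30) = 10 * n + 30 * (m * n)" by (simp add: algebra_simps)
    ultimately have "8 + (n * (10 + m * 30) + 3) \<le> 51 * (m * n + 1)" by (simp only:)
    with lcs_prog_runs show ?thesis
      unfolding m_def n_def
      by (rule runs_weaken) (auto simp: lcs_prog_nth length_lcs_prog)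
  qed
  then show ?thesis unfolding S_def W_def m_def n_def by (rule runs_imp_ram_computes)
qed

theorem theorem1:
  "\<exists>(P :: instr list) (C\<^sub>T :: nat) (C\<^sub>S :: nat) (c :: nat).
    \<forall>(k :: nat) (X :: 'a list) (Y :: 'a list) (m :: nat) (n :: nat).
      k \<ge> 1 \<longrightarrow> length X = m \<longrightarrow> length Y = n \<longrightarrow> n \<ge> m \<longrightarrow>
      (\<exists>Z t. is_LCS_kplus k X Y Z
         \<and> ram_computes P k X Y (C\<^sub>S * (k * m + 1)) ((m + n + k + 2) ^ c) t (length Z)
         \<and> t \<le> C\<^sub>T * (m * n + 1))"
proof (rule exI[of _ lcs_prog], rule exI[of _ 51], rule exI[of _ 64], rule exI[of _ 4], intro allI impI)
  fix k m n :: nat and X Y :: "'a list"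
  assume k: "k \<ge> 1" and m: "length X = m" and n: "length Y = n" and mn: "n \<ge> m"
  obtain Z where Z: "is_LCS_kplus k X Y Z" "length Z = prefix_opt k X Y m n"
    using prefix_opt_is_LCS[OF k, of X Y] m n by auto
  obtain t where t: "t \<le> 51 * (m * n + 1)"
    "ram_computes lcs_prog k X Y (64 * (k * m + 1)) ((m + n + k + 2) ^ 4) t (prefix_opt k X Y m n)"
    using lcs_prog_correct[OF k, of X Y] m n mn by auto
  show "\<exists>Z t. is_LCS_kplus k X Y Z
         \<and> ram_computes lcs_prog k X Y (64 * (k * m + 1)) ((m + n + k + 2) ^ 4) t (length Z)
         \<and> t \<le> 51 * (m * n + 1)"
    using Z(1) t unfolding Z(2)[symmetric] by blast
qed

end
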